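(* For every integer $n>0$, let $\alpha_n$ be the denominator of the rational number $B_n^*$ written in reduced form. Then $$\nu_2(\alpha_n) = -\nu_2(B^*_n) = 2 + \nu_2(n) - \begin{cases} 1 & \text{if } n \equiv 6 \bmod 12, \\ 2 & \text{if } n \equiv 0 \bmod 12, \\ 0 & \text{otherwise.}\end{cases}$$ In particular, $\alpha_n$ is divisible by $4$.
   Context: The Bernoulli numbers $B_r$ are defined by $\frac{t}{e^t-1}=\sum_{r\ge 0} B_r\frac{t^r}{r!}$ (so $B_1=-\tfrac12$). For $n\ge 1$ the modified Bernoulli numbers are $B_n^*=\sum_{r=0}^n \binom{n+r}{2r}\frac{B_r}{n+r}$. $\nu_2$ denotes the $2$-adic valuation on $\mathbb{Q}$. *)

theory Defs
  imports "HOL-Computational_Algebra.Computational_Algebra"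
begin

(* The series exp(t) - 1 has subdegree 1, so it is not a unit; the library division of power
   series cancels the common factor t. *)
definition bernoulli_number :: "nat \<Rightarrow> rat" where
  "bernoulli_number r = fact r * fps_nth (fps_X / (fps_exp 1 - 1)) r"

lemma bernoulli_number_egf:
  "Abs_fps (\<lambda>r. bernoulli_number r / fact r) * (fps_exp 1 - 1) = fps_X"
proof -
  have "fps_nth (fps_exp (1::rat) - 1) 1 = 1"
    by simp
  then have nz: "fps_exp (1::rat) - 1 \<noteq> 0"
    by (metis fps_zero_nth zero_neq_one)
  have "subdegree (fps_exp (1::rat) - 1) = 1"
    by (rule subdegreeI) auto
  then have "(fps_exp (1::rat) - 1) dvd fps_X"
    using nz by (simp add: fps_dvd_iff)
  moreover have "Abs_fps (\<lambda>r. bernoulli_number r / fact r) = fps_X / (fps_exp 1 - 1)"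
    by (rule fps_ext) (simp add: bernoulli_number_def)
  ultimately show ?thesis
    by simp
qed

definition modified_bernoulli :: "nat \<Rightarrow> rat" where
  "modified_bernoulli n =
     (\<Sum>r=0..n. of_nat ((n + r) choose (2 * r)) * (bernoulli_number r / of_nat (n + r)))"

definition rat_denom :: "rat \<Rightarrow> int" where
  "rat_denom x = snd (quotient_of x)"

(* The p-adic valuation on the rationals, restricted to nonzero arguments: at 0, where the
   valuation is infinite, this function has the arbitrary value 0. *)
definition padic_valuation :: "nat \<Rightarrow> rat \<Rightarrow> int" where
  "padic_valuation p x =
     int (multiplicity (int p) (fst (quotient_of x)))
     - int (multiplicity (int p) (snd (quotient_of x)))"

end

(* Let E be the linear functional on polynomials with E(z^r) = B_r, and let P_n be the polynomial
   with P_n(x + 1/x - 2) = x^n + x^(-n).  Its coefficients are 2n/(n + r) (n + r choose 2r), so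
   2n B*_n = E(P_n).  The identity E(f(z + 1)) - E(f(z)) = f'(0) gives E((z)_k) = (-1)^k k!/(k + 1)
   for the falling factorials (z)_k.  Since 2 k!/(k + 1) is divisible by 8 in the 2-adic integers
   unless k = 0, 1, 2, 3, 7, the number 2 E(P_n) modulo 8 depends only on the coefficients of
   (z)_0, ..., (z)_3 modulo 8 and of (z)_7 modulo 2 in P_n.  The three-term recurrence for P_n makes
   these periodic in n with period 24, and a finite computation gives the 2-adic valuation. *)
theory Submission
  imports Defs
begin

section \<open>The umbral functional of the Bernoulli numbers\<close>

text \<open>Compares coefficients of t^m in the generating function identity. As exp(t) - 1 has no
  constant term, the term \<open>r = m\<close> is absent there and reappears on the right.\<close>

lemma bernoulli_number_binomial_sum:
  "(\<Sum>r\<le>m. of_nat (m choose r) * bernoulli_number r) = bernoulli_number m + (if m = 1 then 1 else 0)"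
proof -
  have "(\<Sum>r\<le>m. bernoulli_number r / fact r * fps_nth (fps_exp 1 - 1) (m - r)) = fps_nth fps_X m"
    using arg_cong [OF bernoulli_number_egf, of "\<lambda>f. fps_nth f m"]
    by (simp add: fps_mult_nth atLeast0AtMost)
  moreover have "(\<Sum>r\<le>m. of_nat (m choose r) * bernoulli_number r)
      = fact m * (\<Sum>r\<le>m. bernoulli_number r / fact r * fps_nth (fps_exp 1 - 1) (m - r))
        + (\<Sum>r\<le>m. if r = m then bernoulli_number m else 0)"
    unfolding sum_distrib_left sum.distrib [symmetric]
    by (intro sum.cong refl) (auto simp: binomial_fact)
  ultimately show ?thesis
    by (auto simp: fps_X_def)
qed

definition bernoulli_umbral :: "rat poly \<Rightarrow> rat" where
  "bernoulli_umbral p = (\<Sum>i\<le>degree p. coeff p i * bernoulli_number i)"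

lemma bernoulli_umbral_altdef:
  "degree p \<le> N \<Longrightarrow> bernoulli_umbral p = (\<Sum>i\<le>N. coeff p i * bernoulli_number i)"
  unfolding bernoulli_umbral_def by (rule sum.mono_neutral_left) (auto simp: coeff_eq_0)

lemma bernoulli_umbral_add: "bernoulli_umbral (p + q) = bernoulli_umbral p + bernoulli_umbral q"
proof -
  let ?N = "max (degree p) (degree q)"
  have "degree (p + q) \<le> ?N" by (rule degree_add_le) auto
  then show ?thesis
    by (simp add: bernoulli_umbral_altdef [of _ ?N] sum.distrib distrib_right)
qed

lemma bernoulli_umbral_smult: "bernoulli_umbral (smult c p) = c * bernoulli_umbral p"
  by (simp add: bernoulli_umbral_altdef [of _ "degree p"] sum_distrib_left mult.assoc)

lemma bernoulli_umbral_sum: "bernoulli_umbral (\<Sum>i\<in>A. f i) = (\<Sum>i\<in>A. bernoulli_umbral (f i))"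
  by (induction A rule: infinite_finite_induct)
    (auto simp: bernoulli_umbral_add bernoulli_umbral_def [of 0])

lemma bernoulli_umbral_linear_power:
  "bernoulli_umbral ([:1, 1:] ^ m) = bernoulli_number m + (if m = 1 then 1 else 0)"
proof -
  have "bernoulli_umbral ([:1, 1:] ^ m) = (\<Sum>i\<le>m. of_nat (m choose i) * bernoulli_number i)"
    by (subst bernoulli_umbral_altdef [of _ m])
      (auto simp: degree_linear_power coeff_linear_poly_power)
  then show ?thesis by (simp add: bernoulli_number_binomial_sum)
qed

text \<open>By linearity only the powers of z + 1 matter, and of these only the first gains an extra
  1. The correction is therefore f'(0).\<close>

lemma bernoulli_umbral_shift:
  "bernoulli_umbral (pcompose p [:1, 1:]) = bernoulli_umbral p + coeff p 1"
proof -
  have "pcompose ([:0, 1:] ^ i) [:1, 1:] = ([:1, 1:] ^ i :: rat poly)" for i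
    by (induction i) (simp_all add: pcompose_1 pcompose_mult pcompose_pCons)
  then have "pcompose p [:1, 1:] = (\<Sum>i\<le>degree p. smult (coeff p i) ([:1, 1:] ^ i))"
    by (subst poly_as_sum_of_monoms [of p, symmetric])
      (simp add: pcompose_sum pcompose_smult monom_altdef)
  then have "bernoulli_umbral (pcompose p [:1, 1:])
      = bernoulli_umbral p + (\<Sum>i\<le>degree p. if i = 1 then coeff p 1 else 0)"
    by (auto simp: bernoulli_umbral_sum bernoulli_umbral_smult bernoulli_umbral_linear_power
        bernoulli_umbral_def [of p] sum.distrib [symmetric] distrib_left
        simp del: sum.delta sum.delta' intro!: sum.cong)
  then show ?thesis by (auto simp: coeff_eq_0)
qed

section \<open>Falling factorials\<close>

fun falling_factorial_poly :: "nat \<Rightarrow> rat poly" where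
  "falling_factorial_poly 0 = 1"
| "falling_factorial_poly (Suc k) = falling_factorial_poly k * [:- of_nat k, 1:]"

lemma falling_factorial_poly_shift:
  "pcompose (falling_factorial_poly (Suc k)) [:1, 1:] = [:1, 1:] * falling_factorial_poly k"
proof (induction k)
  case 0
  show ?case by (simp add: pcompose_pCons one_pCons)
next
  case (Suc k)
  have "pcompose (falling_factorial_poly (Suc (Suc k))) [:1, 1:]
      = pcompose (falling_factorial_poly (Suc k)) [:1, 1:] * [:- of_nat k, 1:]"
    by (subst falling_factorial_poly.simps(2), subst pcompose_mult)
      (simp add: pcompose_pCons del: falling_factorial_poly.simps)
  then show ?case
    unfolding Suc.IH by (simp only: falling_factorial_poly.simps mult.assoc)
qed

text \<open>The linear coefficient is the product of the constant terms -1, ..., -k of the factors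
  other than z.\<close>

lemma coeff_falling_factorial_poly:
  "coeff (falling_factorial_poly (Suc k)) 0 = 0"
  "coeff (falling_factorial_poly (Suc k)) 1 = (- 1) ^ k * fact k"
proof (induction k)
  case 0
  show "coeff (falling_factorial_poly (Suc 0)) 0 = 0" by simp
  show "coeff (falling_factorial_poly (Suc 0)) 1 = (- 1) ^ 0 * fact 0" by simp
next
  case (Suc k)
  have *: "falling_factorial_poly (Suc (Suc k)) = [:- of_nat (Suc k), 1:] * falling_factorial_poly (Suc k)"
    by (simp only: falling_factorial_poly.simps mult.commute mult.left_commute)
  show "coeff (falling_factorial_poly (Suc (Suc k))) 0 = 0"
    unfolding * using Suc by (simp del: falling_factorial_poly.simps)
  show "coeff (falling_factorial_poly (Suc (Suc k))) 1 = (- 1) ^ Suc k * fact (Suc k)"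
    unfolding * using Suc by (simp del: falling_factorial_poly.simps add: algebra_simps)
qed

text \<open>The shift turns (z)_(k+1) into (z + 1) (z)_k = (z)_(k+1) + (k + 1) (z)_k. Applying E
  equates (k + 1) E((z)_k) with the linear coefficient of (z)_(k+1).\<close>

lemma bernoulli_umbral_falling_factorial:
  "bernoulli_umbral (falling_factorial_poly k) = (- 1) ^ k * fact k / of_nat (k + 1)"
proof -
  have "smult (of_nat (k + 1)) (falling_factorial_poly k) + falling_factorial_poly (Suc k)
      = pcompose (falling_factorial_poly (Suc k)) [:1, 1:]"
    unfolding falling_factorial_poly_shift by (simp add: algebra_simps smult_add_left)
  then have "of_nat (k + 1) * bernoulli_umbral (falling_factorial_poly k) = (- 1) ^ k * fact k"
    using bernoulli_umbral_shift [of "falling_factorial_poly (Suc k)"]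
    unfolding coeff_falling_factorial_poly(2)
    by (metis add.commute add_left_cancel bernoulli_umbral_add bernoulli_umbral_smult)
  then show ?thesis by (simp add: field_simps del: of_nat_add)
qed

section \<open>The polynomials P_n and the modified Bernoulli numbers\<close>

text \<open>This is P_n: multiplying x^n + x^(-n) by x + 1/x = z + 2 gives the recurrence. For x =
  exp(i t) the value is 2 cos(n t), whence the name.\<close>

fun cosine_poly :: "nat \<Rightarrow> rat poly" where
  "cosine_poly 0 = [:2:]"
| "cosine_poly (Suc 0) = [:2, 1:]"
| "cosine_poly (Suc (Suc n)) = [:2, 1:] * cosine_poly (Suc n) - cosine_poly n"

text \<open>Pascal's rule, iterated: a second difference in the upper argument lowers the lower one
  by two. This is the recurrence of \<open>cosine_poly\<close> on coefficients.\<close>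

lemma binomial_sum_second_difference:
  "(n + 2 + Suc r choose (2 * Suc r)) + (n + Suc r choose (2 * Suc r))
   = 2 * (n + 1 + Suc r choose (2 * Suc r)) + (n + 1 + r choose (2 * r))"
proof -
  have "n + 2 + Suc r = Suc (Suc (Suc (n + r)))" "2 * Suc r = Suc (Suc (2 * r))" by auto
  then show ?thesis by (simp add: binomial_Suc_Suc)
qed

lemma coeff_cosine_poly:
  "coeff (cosine_poly (Suc n)) r = of_nat (n + 1 + r choose (2 * r)) + of_nat (n + r choose (2 * r))"
proof (induction n arbitrary: r rule: induct_nat_012)
  case 0
  consider "r = 0" | "r = 1" | "r > 1" by linarith
  then show ?case
    by cases (auto simp: coeff_pCons binomial_eq_0 numeral_2_eq_2 split: nat.splits)
next
  case 1
  consider "r = 0" | "r = 1" | "r = 2" | "r > 2" by linarith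
  then show ?case
    by cases (auto simp: coeff_pCons numeral_2_eq_2 binomial_eq_0 split: nat.splits)
next
  case (ge2 n)
  show ?case
  proof (cases r)
    case 0
    then show ?thesis
      using ge2(1) [of 0] ge2(2) [of 0] cosine_poly.simps(3) [of "Suc n"]
      by (simp del: cosine_poly.simps)
  next
    case (Suc s)
    have a: "of_nat (n + 2 + Suc s choose (2 * Suc s)) + of_nat (n + Suc s choose (2 * Suc s))
      = (2 * of_nat (n + 1 + Suc s choose (2 * Suc s)) + of_nat (n + 1 + s choose (2 * s)) :: rat)"
      for n using arg_cong [OF binomial_sum_second_difference [of n s], of "of_nat :: nat \<Rightarrow> rat"]
      by (simp only: of_nat_add of_nat_mult of_nat_numeral)
    show ?thesis
      using a [of n] a [of "Suc n"] ge2(1)[of "Suc s"] ge2(2)[of "Suc s"] ge2(2)[of s]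
      by (simp add: Suc del: mult_Suc_right binomial_Suc_Suc)
  qed
qed

lemma degree_cosine_poly: "degree (cosine_poly n) \<le> n"
proof (cases n)
  case (Suc m)
  then show ?thesis
    by (auto intro!: degree_le simp: coeff_cosine_poly binomial_eq_0)
qed auto

lemma modified_bernoulli_eq_umbral:
  assumes "n > 0"
  shows "2 * of_nat n * modified_bernoulli n = bernoulli_umbral (cosine_poly n)"
proof -
  obtain m where n: "n = Suc m" using assms by (cases n) auto
  have "2 * of_nat n * (of_nat (n + r choose (2 * r)) / of_nat (n + r)) = coeff (cosine_poly n) r"
    if "r \<le> n" for r
  proof -
    \<comment> \<open>Absorption makes the second binomial of the coefficient (n - r)/(n + r) times
      the first, so their sum is 2n/(n + r) times the first.\<close>
    have "(n - r) * (n + r choose (2 * r)) = (n + r) * (m + r choose (2 * r))"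
      using binomial_absorb_comp [of "n + r" "2 * r"] n by simp
    then have "(of_nat n - of_nat r) * of_nat (n + r choose (2 * r))
        = ((of_nat n + of_nat r) * of_nat (m + r choose (2 * r)) :: rat)"
      using that by (metis of_nat_add of_nat_diff of_nat_mult)
    moreover have "of_nat n + of_nat r \<noteq> (0 :: rat)" using assms
      by (metis add_gr_0 of_nat_add of_nat_eq_0_iff not_gr_zero)
    moreover have "coeff (cosine_poly n) r
        = of_nat (n + r choose (2 * r)) + of_nat (m + r choose (2 * r))"
      by (simp add: n coeff_cosine_poly del: binomial_Suc_Suc)
    ultimately show ?thesis
      by (simp add: field_simps)
  qed
  then show ?thesis
    unfolding modified_bernoulli_def bernoulli_umbral_altdef [OF degree_cosine_poly] atLeast0AtMost
      sum_distrib_left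
    by (intro sum.cong refl) (metis (no_types, lifting) atMost_iff mult.assoc times_divide_eq_left times_divide_eq_right)
qed

section \<open>Expansion of P_n in falling factorials\<close>

text \<open>The coefficient of (z)_k in P_n. The recurrence comes from (z + 2) (z)_k = (z)_(k+1) +
  (k + 2) (z)_k; integrality is what permits reduction modulo 8.\<close>

fun cosine_newton_coeff :: "nat \<Rightarrow> nat \<Rightarrow> int" where
  "cosine_newton_coeff 0 k = (if k = 0 then 2 else 0)"
| "cosine_newton_coeff (Suc 0) k = (if k = 0 then 2 else if k = 1 then 1 else 0)"
| "cosine_newton_coeff (Suc (Suc n)) k =
     (if k = 0 then 0 else cosine_newton_coeff (Suc n) (k - 1))
     + (int k + 2) * cosine_newton_coeff (Suc n) k - cosine_newton_coeff n k"

lemma cosine_newton_coeff_eq_0: "k > n \<Longrightarrow> cosine_newton_coeff n k = 0"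
  by (induction n k rule: cosine_newton_coeff.induct) auto

text \<open>The free bound \<open>N\<close> lets the induction expand row n + 1 only up to
  \<open>N - 1\<close>, so that multiplication by z + 2 ends at \<open>N\<close>.\<close>

lemma cosine_poly_newton:
  assumes "n \<le> N"
  shows "cosine_poly n = (\<Sum>k\<le>N. smult (of_int (cosine_newton_coeff n k)) (falling_factorial_poly k))"
  using assms
proof (induction n arbitrary: N rule: induct_nat_012)
  case 0
  have "(\<Sum>k\<le>N. smult (of_int (cosine_newton_coeff 0 k)) (falling_factorial_poly k))
      = (\<Sum>k\<le>N. if k = 0 then [:2:] else 0)"
    by (intro sum.cong) auto
  then show ?case by simp
next
  case 1
  have "(\<Sum>k\<le>N. smult (of_int (cosine_newton_coeff (Suc 0) k)) (falling_factorial_poly k))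
      = (\<Sum>k\<in>{0, 1}. smult (of_int (cosine_newton_coeff (Suc 0) k)) (falling_factorial_poly k))"
    using 1 by (intro sum.mono_neutral_right) auto
  then show ?case by simp
next
  case (ge2 n)
  let ?F = falling_factorial_poly
  let ?a = "\<lambda>n k. of_int (cosine_newton_coeff n k) :: rat"
  obtain M where M: "N = Suc M" "Suc n \<le> M" using ge2 by (cases N) auto
  have "[:2, 1:] * ?F k = ?F (Suc k) + smult (of_nat k + 2) (?F k)" for k
    by (simp add: algebra_simps smult_add_left)
  then have "[:2, 1:] * (\<Sum>k\<le>M. smult (?a (Suc n) k) (?F k))
      = (\<Sum>k\<le>M. smult (?a (Suc n) k) (?F (Suc k)))
        + (\<Sum>k\<le>M. smult ((of_nat k + 2) * ?a (Suc n) k) (?F k))"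
    by (simp only: sum_distrib_left sum.distrib [symmetric] mult_smult_right smult_add_right
        smult_smult mult.commute)
  also have "(\<Sum>k\<le>M. smult (?a (Suc n) k) (?F (Suc k)))
      = (\<Sum>k\<le>N. smult (if k = 0 then 0 else ?a (Suc n) (k - 1)) (?F k))"
    unfolding M(1) by (subst sum.atMost_Suc_shift) simp
  also have "(\<Sum>k\<le>M. smult ((of_nat k + 2) * ?a (Suc n) k) (?F k))
      = (\<Sum>k\<le>N. smult ((of_nat k + 2) * ?a (Suc n) k) (?F k))"
    using M by (simp add: cosine_newton_coeff_eq_0)
  finally have "cosine_poly (Suc (Suc n))
      = (\<Sum>k\<le>N. smult (if k = 0 then 0 else ?a (Suc n) (k - 1)) (?F k))
        + (\<Sum>k\<le>N. smult ((of_nat k + 2) * ?a (Suc n) k) (?F k))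
        - (\<Sum>k\<le>N. smult (?a n k) (?F k))"
    using ge2.IH(1) [of N] ge2.IH(2) [of M] ge2.prems M by simp
  also have "\<dots> = (\<Sum>k\<le>N. smult (?a (Suc (Suc n)) k) (?F k))"
    unfolding sum.distrib [symmetric] sum_subtractf [symmetric]
      smult_add_left [symmetric] smult_diff_left [symmetric]
    by (intro sum.cong refl arg_cong2 [of _ _ _ _ smult]) simp
  finally show ?case .
qed

lemma bernoulli_umbral_cosine_poly:
  assumes "n \<le> N"
  shows "bernoulli_umbral (cosine_poly n)
    = (\<Sum>k\<le>N. of_int (cosine_newton_coeff n k) * ((- 1) ^ k * fact k / of_nat (k + 1)))"
  unfolding cosine_poly_newton [OF assms] bernoulli_umbral_sum bernoulli_umbral_smult
    bernoulli_umbral_falling_factorial ..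

section \<open>Rationals integral at 2\<close>

text \<open>The localization of the integers at 2. A congruence of rationals modulo 8 is written
  below as \<open>two_integral ((x - y) / 8)\<close>.\<close>

definition two_integral :: "rat \<Rightarrow> bool" where
  "two_integral x \<longleftrightarrow> (\<exists>d z. odd d \<and> of_int d * x = of_int z)"

lemma two_integralI: "odd d \<Longrightarrow> of_int d * x = of_int z \<Longrightarrow> two_integral x"
  by (auto simp: two_integral_def)

lemma two_integral_of_int: "two_integral (of_int z)"
  by (rule two_integralI [of 1]) auto

lemma two_integral_add:
  assumes "two_integral x" "two_integral y"
  shows "two_integral (x + y)"
proof -
  obtain c w where c: "odd c" "of_int c * x = of_int w"
    using assms(1) by (auto simp: two_integral_def)
  obtain d z where d: "odd d" "of_int d * y = of_int z"
    using assms(2) by (auto simp: two_integral_def)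
  have "of_int (c * d) * (x + y) = of_int d * (of_int c * x) + of_int c * (of_int d * y)"
    by (simp add: algebra_simps)
  also have "\<dots> = of_int (d * w + c * z)" using c d by simp
  finally show ?thesis by (rule two_integralI [rotated]) (use c d in simp)
qed

lemma two_integral_of_int_mult:
  assumes "two_integral x"
  shows "two_integral (of_int c * x)"
proof -
  obtain d z where d: "odd d" "of_int d * x = of_int z"
    using assms by (auto simp: two_integral_def)
  then have "of_int d * (of_int c * x) = of_int (c * z)" by simp
  with d(1) show ?thesis by (rule two_integralI)
qed

lemma two_integral_sum:
  "(\<And>k. k \<in> A \<Longrightarrow> two_integral (f k)) \<Longrightarrow> two_integral (\<Sum>k\<in>A. f k)"
  using two_integral_of_int [of 0]
  by (induction A rule: infinite_finite_induct) (auto intro: two_integral_add)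

section \<open>Umbral values modulo 8\<close>

text \<open>This makes 2 k!/(k + 1) divisible by 8 in the 2-adic integers. If 2^e is the exact power
  of 2 in k + 1, then 2^(e+2) must divide k!; for e at most 5 already 8! suffices.\<close>

lemma four_mult_Suc_dvd_odd_mult_fact:
  assumes "k \<ge> 8"
  shows "\<exists>m. odd m \<and> 4 * (k + 1) dvd m * (fact k :: nat)"
proof -
  obtain e m where e: "k + 1 = 2 ^ e * m" "odd m"
    by (rule multiplicity_decompose' [of "k + 1" 2]) auto
  have "2 ^ (e + 2) dvd (fact k :: nat)"
  proof (cases "e \<le> 5")
    case True
    then have "(2 :: nat) ^ (e + 2) dvd 2 ^ 7" by (intro le_imp_power_dvd) auto
    also have "(2 :: nat) ^ 7 dvd fact 8" by (simp add: fact_numeral)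
    also have "(fact 8 :: nat) dvd fact k" using assms by (rule fact_dvd)
    finally show ?thesis .
  next
    case False
    \<comment> \<open>Half of 2^e is at most k, so q! divides k!. Here q supplies e - 1 factors 2,
      and (q - 1)! three more through 4!.\<close>
    define q :: nat where "q = 2 ^ (e - 1)"
    have "(2 :: nat) ^ 3 \<le> q" unfolding q_def using False by (intro power_increasing) auto
    then have q8: "q \<ge> 8" by simp
    have eq: "2 ^ e = 2 * q" using False by (cases e) (auto simp: q_def)
    have "8 dvd (fact 4 :: nat)" by (simp add: fact_numeral)
    also have "(fact 4 :: nat) dvd fact (q - 1)" using q8 by (intro fact_dvd) auto
    finally have "q * 8 dvd q * fact (q - 1)" by (rule mult_dvd_mono [OF dvd_refl])
    also have "q * fact (q - 1) = fact q" using q8 by (simp add: fact_reduce)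
    also have "(fact q :: nat) dvd fact k"
    proof (rule fact_dvd)
      have "2 * q \<le> k + 1" unfolding e(1) eq using e(2) by (cases m) auto
      then show "q \<le> k" using q8 by simp
    qed
    finally show ?thesis using eq by (simp add: mult.commute)
  qed
  then have "m * 2 ^ (e + 2) dvd m * (fact k :: nat)" by (rule mult_dvd_mono [OF dvd_refl])
  moreover have "m * 2 ^ (e + 2) = 4 * (k + 1)" unfolding e(1) by simp
  ultimately show ?thesis using e(2) by metis
qed

text \<open>Residues modulo 8, in the 2-adic integers, of twice the umbral value of the falling factorials.\<close>
definition bernoulli_weight :: "nat \<Rightarrow> int" where
  "bernoulli_weight k =
     (if k = 0 then 2 else if k = 1 then -1 else if k = 2 then 4 else if k = 3 then -3
      else if k = 7 then 4 else 0)"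

lemma bernoulli_weight_cong:
  "two_integral ((2 * ((- 1) ^ k * fact k / of_nat (k + 1)) - of_int (bernoulli_weight k)) / 8)"
proof (cases "k \<ge> 8")
  case True
  obtain m where m: "odd m" "4 * (k + 1) dvd m * (fact k :: nat)"
    using four_mult_Suc_dvd_odd_mult_fact [OF True] by blast
  then obtain c where c: "m * fact k = 4 * (k + 1) * c" by (auto elim: dvdE)
  have "of_nat (m * fact k) = (of_nat (4 * (k + 1) * c) :: rat)" by (simp only: c)
  then have "of_nat m * (fact k / of_nat (k + 1)) = (4 * of_nat c :: rat)"
    by (simp add: field_simps)
  moreover have "of_nat m * (2 * ((- 1) ^ k * fact k / of_nat (k + 1)))
      = 2 * (- 1) ^ k * (of_nat m * (fact k / of_nat (k + 1)) :: rat)"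
    by simp
  ultimately have eq: "of_nat m * (2 * ((- 1) ^ k * fact k / of_nat (k + 1)))
      = 8 * ((- 1) ^ k * of_nat c :: rat)"
    by simp
  have "of_int (int m) * ((2 * ((- 1) ^ k * fact k / of_nat (k + 1)) - of_int (bernoulli_weight k)) / 8)
      = of_nat m * (2 * ((- 1) ^ k * fact k / of_nat (k + 1))) / (8 :: rat)"
    using True by (simp add: bernoulli_weight_def)
  also have "\<dots> = of_int ((- 1) ^ k * int c)"
    unfolding eq by simp
  finally show ?thesis by (rule two_integralI [rotated]) (use m in simp)
next
  case False
  then consider "k = 0" | "k = 1" | "k = 2" | "k = 3" | "k = 4" | "k = 5" | "k = 6" | "k = 7"
    by linarith
  then show ?thesis
  proof cases
    \<comment> \<open>In each case the witnesses are an odd denominator of the quotient by 8 and the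
      resulting numerator.\<close>
    case 1 then show ?thesis by (intro two_integralI [of 1 _ 0]) (simp_all add: bernoulli_weight_def)
  next
    case 2 then show ?thesis by (intro two_integralI [of 1 _ 0]) (simp_all add: bernoulli_weight_def)
  next
    case 3 then show ?thesis
      by (intro two_integralI [of 3 _ "-1"]) (simp_all add: bernoulli_weight_def fact_numeral)
  next
    case 4 then show ?thesis
      by (intro two_integralI [of 1 _ 0]) (simp_all add: bernoulli_weight_def fact_numeral)
  next
    case 5 then show ?thesis
      by (intro two_integralI [of 5 _ 6]) (simp_all add: bernoulli_weight_def fact_numeral)
  next
    case 6 then show ?thesis
      by (intro two_integralI [of 1 _ "-5"]) (simp_all add: bernoulli_weight_def fact_numeral)
  next
    case 7 then show ?thesis
      by (intro two_integralI [of 7 _ 180]) (simp_all add: bernoulli_weight_def fact_numeral)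
  next
    case 8 then show ?thesis
      by (intro two_integralI [of 1 _ "-158"]) (simp_all add: bernoulli_weight_def fact_numeral)
  qed
qed

text \<open>The argument is an arbitrary sequence, to admit both the exact coefficients and their
  residues.\<close>

definition weighted_newton_sum :: "(nat \<Rightarrow> int) \<Rightarrow> int" where
  "weighted_newton_sum a = 2 * a 0 - a 1 + 4 * a 2 - 3 * a 3 + 4 * a 7"

lemma bernoulli_umbral_cosine_poly_cong:
  "two_integral ((2 * bernoulli_umbral (cosine_poly n)
     - of_int (weighted_newton_sum (cosine_newton_coeff n))) / 8)"
proof -
  let ?a = "cosine_newton_coeff n"
  let ?b = "\<lambda>k. (- 1) ^ k * fact k / of_nat (k + 1) :: rat"
  have "weighted_newton_sum ?a = (\<Sum>k\<in>{0, 1, 2, 3, 7}. ?a k * bernoulli_weight k)"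
    by (simp add: weighted_newton_sum_def bernoulli_weight_def)
  also have "\<dots> = (\<Sum>k\<le>n + 7. ?a k * bernoulli_weight k)"
    by (intro sum.mono_neutral_left) (auto simp: bernoulli_weight_def)
  finally have "(2 * bernoulli_umbral (cosine_poly n) - of_int (weighted_newton_sum ?a)) / 8
      = (\<Sum>k\<le>n + 7. of_int (?a k) * ((2 * ?b k - of_int (bernoulli_weight k)) / 8))"
    by (subst bernoulli_umbral_cosine_poly [of n "n + 7"])
      (simp_all add: sum_distrib_left sum_subtractf [symmetric] sum_divide_distrib algebra_simps
        del: of_nat_add of_nat_Suc)
  then show ?thesis
    by (simp only:) (intro two_integral_sum two_integral_of_int_mult bernoulli_weight_cong)
qed

section \<open>Periodicity of the residues\<close>

text \<open>Modulus 2 suffices from index 4 on, since only index 7 is used there, with weight 4. The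
  recurrence at index \<open>k\<close> involves index \<open>k - 1\<close>, so it is essential that the moduli form a
  divisor chain. With modulus 8 throughout, the period would be 96 instead of 24.\<close>
definition newton_modulus :: "nat \<Rightarrow> int" where
  "newton_modulus k = (if k < 4 then 8 else 2)"

definition newton_residues :: "nat \<Rightarrow> int list" where
  "newton_residues n = map (\<lambda>k. cosine_newton_coeff n k mod newton_modulus k) [0..<8]"

text \<open>One step of the recurrence on two consecutive rows. Column \<open>k\<close> needs only
  columns \<open>k - 1\<close> and \<open>k\<close>, so truncation after index 7 is
  harmless.\<close>

definition next_residues :: "int list \<times> int list \<Rightarrow> int list \<times> int list" where
  "next_residues = (\<lambda>(u, v). (v, map (\<lambda>k. ((if k = 0 then 0 else v ! (k - 1))
     + (int k + 2) * v ! k - u ! k) mod newton_modulus k) [0..<8]))"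

lemma next_residues:
  "next_residues (newton_residues n, newton_residues (Suc n))
   = (newton_residues (Suc n), newton_residues (Suc (Suc n)))"
proof -
  have mod_cong: "(p + b * q - r) mod M = (p' + b * q' - r') mod M"
    if "p mod M = p' mod M" "q mod M = q' mod M" "r mod M = r' mod M" for M p q r p' q' r' b :: int
    by (intro mod_diff_cong mod_add_cong mod_mult_cong that refl)
  have "((if k = 0 then 0 else newton_residues (Suc n) ! (k - 1))
      + (int k + 2) * newton_residues (Suc n) ! k - newton_residues n ! k) mod newton_modulus k
    = cosine_newton_coeff (Suc (Suc n)) k mod newton_modulus k" if "k < 8" for k
  proof -
    have nth: "newton_residues i ! k = cosine_newton_coeff i k mod newton_modulus k"
      "newton_residues i ! (k - 1) = cosine_newton_coeff i (k - 1) mod newton_modulus (k - 1)" for i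
      using that by (simp_all add: newton_residues_def less_imp_diff_less)
    have "newton_modulus k dvd newton_modulus (k - 1)" by (auto simp: newton_modulus_def)
    then show ?thesis
      unfolding nth cosine_newton_coeff.simps by (intro mod_cong) (simp_all add: mod_mod_cancel)
  qed
  then show ?thesis
    by (simp add: next_residues_def newton_residues_def [of "Suc (Suc n)"])
qed

definition initial_residues :: "int list \<times> int list" where
  "initial_residues = ([2, 0, 0, 0, 0, 0, 0, 0], [2, 1, 0, 0, 0, 0, 0, 0])"

lemma newton_residues_eq_iterate:
  "(newton_residues n, newton_residues (Suc n)) = (next_residues ^^ n) initial_residues"
proof (induction n)
  case 0
  show ?case
    by (simp add: newton_residues_def newton_modulus_def initial_residues_def upt_rec)
next
  case (Suc n)
  then show ?case by (simp flip: next_residues)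
qed

text \<open>Two consecutive rows determine all later ones, so one return to the initial pair proves
  periodicity.\<close>

lemma initial_residues_period: "(next_residues ^^ 24) initial_residues = initial_residues"
  by code_simp

lemma newton_residues_mod: "newton_residues n = newton_residues (n mod 24)"
proof -
  have "(next_residues ^^ (24 * q)) initial_residues = initial_residues" for q
    by (induction q) (simp_all add: funpow_add initial_residues_period)
  then have "(next_residues ^^ (n mod 24 + 24 * (n div 24))) initial_residues
      = (next_residues ^^ (n mod 24)) initial_residues"
    unfolding funpow_add by simp
  then show ?thesis
    unfolding newton_residues_eq_iterate [symmetric] by simp
qed

section \<open>The exact power of 2 in the weighted sum\<close>

definition exceptional_exponent :: "nat \<Rightarrow> nat" where
  "exceptional_exponent n = (if n mod 12 = 6 then 1 else if n mod 12 = 0 then 2 else 0)"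

text \<open>Expresses that \<open>t\<close> has 2-adic valuation exactly
  \<open>exceptional_exponent n\<close>, as a residue condition that can be evaluated. The exponent
  is at most 2, so only t modulo 8 matters.\<close>

definition has_exceptional_exponent :: "nat \<Rightarrow> int \<Rightarrow> bool" where
  "has_exceptional_exponent n t \<longleftrightarrow>
     t mod 2 ^ (exceptional_exponent n + 1) = 2 ^ exceptional_exponent n"

lemma has_exceptional_exponent_diff:
  "has_exceptional_exponent n (t - 8 * c) \<longleftrightarrow> has_exceptional_exponent n t"
proof -
  have "(2 :: int) ^ (exceptional_exponent n + 1) dvd 8"
    by (auto simp: exceptional_exponent_def)
  then show ?thesis
    unfolding has_exceptional_exponent_def by (auto elim!: dvdE simp: mult.assoc mod_diff_eq [symmetric])
qed

lemma has_exceptional_exponent_residues: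
  "n < 24 \<Longrightarrow> has_exceptional_exponent n (weighted_newton_sum (nth (newton_residues n)))"
proof -
  have "\<forall>n\<in>set [0..<24]. has_exceptional_exponent n
     (weighted_newton_sum (nth (fst ((next_residues ^^ n) initial_residues))))"
    by code_simp
  then show "n < 24 \<Longrightarrow> ?thesis"
    by (simp flip: newton_residues_eq_iterate)
qed

lemma has_exceptional_exponent_weighted_newton_sum:
  "has_exceptional_exponent n (weighted_newton_sum (cosine_newton_coeff n))"
proof -
  let ?a = "cosine_newton_coeff n"
  have "exceptional_exponent (n mod 24) = exceptional_exponent n"
    by (simp add: exceptional_exponent_def mod_mod_cancel)
  then have "has_exceptional_exponent n (weighted_newton_sum (nth (newton_residues n)))"
    using has_exceptional_exponent_residues [of "n mod 24"] newton_residues_mod [of n]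
    by (simp add: has_exceptional_exponent_def)
  \<comment> \<open>Passing to residues changes entries 0 to 3 by multiples of 8 and entry 7 by a
    multiple of 2, which its weight 4 turns into a multiple of 8.\<close>
  moreover have "weighted_newton_sum (nth (newton_residues n)) = weighted_newton_sum ?a
      - 8 * (2 * (?a 0 div 8) - ?a 1 div 8 + 4 * (?a 2 div 8) - 3 * (?a 3 div 8) + ?a 7 div 2)"
    by (simp add: weighted_newton_sum_def newton_residues_def newton_modulus_def algebra_simps
        numeral_2_eq_2 minus_mult_div_eq_mod [symmetric])
  ultimately show ?thesis by (simp only: has_exceptional_exponent_diff)
qed

text \<open>With c at most 2 the exponent, d t is 2^c times an odd number and 8 z is 2^c times an
  even one.\<close>

lemma multiplicity_has_exceptional_exponent:
  assumes "has_exceptional_exponent n t" "odd d"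
  shows "d * t + 8 * z \<noteq> 0" "multiplicity 2 (d * t + 8 * z) = exceptional_exponent n"
proof -
  let ?c = "exceptional_exponent n"
  have "t = 2 ^ ?c * (1 + 2 * (t div 2 ^ (?c + 1)))"
    using assms(1) div_mult_mod_eq [of t "2 ^ (?c + 1)"]
    by (simp add: has_exceptional_exponent_def algebra_simps)
  then obtain u where u: "t = 2 ^ ?c * (1 + 2 * u)" by blast
  obtain v where v: "8 * z = 2 ^ ?c * (2 * v)"
  proof
    show "8 * z = 2 ^ ?c * (2 * (2 ^ (2 - ?c) * z))"
      by (auto simp: exceptional_exponent_def)
  qed
  have eq: "d * t + 8 * z = 2 ^ ?c * (d * (1 + 2 * u) + 2 * v)"
    unfolding u v by (simp add: algebra_simps)
  have odd: "odd (d * (1 + 2 * u) + 2 * v)"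
    using assms(2) by simp
  then show "d * t + 8 * z \<noteq> 0"
    unfolding eq by (metis dvd_0_right mult_eq_0_iff power_not_zero zero_neq_numeral)
  show "multiplicity 2 (d * t + 8 * z) = ?c"
    using eq odd by (rule multiplicity_decomposeI) simp
qed

section \<open>Valuations of fractions and denominators\<close>

text \<open>The fraction w/m may be unreduced: cross-multiply with the reduced form and add
  multiplicities.\<close>

lemma padic_valuation_eqI:
  assumes "prime p" "of_int m * x = of_int w" "m \<noteq> 0" "w \<noteq> 0"
  shows "padic_valuation p x = int (multiplicity (int p) w) - int (multiplicity (int p) m)"
proof -
  obtain a b where ab: "quotient_of x = (a, b)" by (cases "quotient_of x")
  have b: "b > 0" using quotient_of_denom_pos [OF ab] .
  have x: "x = of_int a / of_int b" using quotient_of_div [OF ab] .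
  have "of_int (m * a) = (of_int (w * b) :: rat)"
    using assms(2) b unfolding x by (simp add: field_simps)
  then have eq: "m * a = w * b" by (simp only: of_int_eq_iff)
  with assms b have "a \<noteq> 0" by auto
  have "prime_elem (int p)" using assms(1) by simp
  then have "multiplicity (int p) m + multiplicity (int p) a
      = multiplicity (int p) w + multiplicity (int p) b"
    using eq assms(3,4) b \<open>a \<noteq> 0\<close>
    by (metis less_irrefl prime_elem_multiplicity_mult_distrib)
  then show ?thesis by (simp add: padic_valuation_def ab)
qed

text \<open>A negative valuation puts p into the reduced denominator and hence, by coprimality, not
  into the numerator.\<close>

lemma padic_valuation_denom:
  assumes "prime p" "padic_valuation p x < 0"
  shows "padic_valuation p (of_int (rat_denom x)) = - padic_valuation p x"
proof -
  obtain a b where ab: "quotient_of x = (a, b)" by (cases "quotient_of x")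
  have b: "b > 0" and "coprime a b"
    using quotient_of_denom_pos [OF ab] quotient_of_coprime [OF ab] .
  have "multiplicity (int p) b > 0" using assms(2) by (simp add: padic_valuation_def ab)
  then have "int p dvd b" by (metis not_dvd_imp_multiplicity_0 less_irrefl)
  then have "\<not> int p dvd a"
    using \<open>coprime a b\<close> assms(1) by (meson coprime_common_divisor not_prime_unit prime_nat_int_transfer)
  then show ?thesis
    using padic_valuation_eqI [OF assms(1), of 1 "of_int b" b] b
    by (simp add: padic_valuation_def ab rat_denom_def not_dvd_imp_multiplicity_0)
qed

theorem theorem1p2:
  fixes n :: nat
  assumes "n > 0"
  shows "padic_valuation 2 (of_int (rat_denom (modified_bernoulli n)))
           = - padic_valuation 2 (modified_bernoulli n)
         \<and> - padic_valuation 2 (modified_bernoulli n)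
           = 2 + padic_valuation 2 (of_nat n)
             - (if n mod 12 = 6 then 1 else if n mod 12 = 0 then 2 else 0)
         \<and> 4 dvd rat_denom (modified_bernoulli n)"
proof -
  let ?B = "modified_bernoulli n" and ?t = "weighted_newton_sum (cosine_newton_coeff n)"
  obtain d z where d: "odd d"
    and z: "of_int d * ((2 * bernoulli_umbral (cosine_poly n) - of_int ?t) / 8) = of_int z"
    using bernoulli_umbral_cosine_poly_cong [of n] unfolding two_integral_def by blast
  \<comment> \<open>The factor 4n is twice the 2n of the umbral formula; \<open>d\<close> is the odd
    denominator from the congruence modulo 8.\<close>
  have "of_int (4 * int n * d) * ?B = of_int d * (2 * bernoulli_umbral (cosine_poly n))"
    by (simp flip: modified_bernoulli_eq_umbral [OF assms])
  also have "\<dots> = of_int (d * ?t + 8 * z)"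
    using z by (simp add: algebra_simps)
  finally have eq: "of_int (4 * int n * d) * ?B = of_int (d * ?t + 8 * z)" .
  note w = multiplicity_has_exceptional_exponent [OF has_exceptional_exponent_weighted_newton_sum d]
  have "multiplicity 2 (4 * int n * d) = multiplicity 2 (2 ^ 2 * int n)"
    using d by (simp add: mult.commute [of _ d] multiplicity_prime_elem_times_other)
  also have "\<dots> = 2 + multiplicity 2 (int n)"
    using assms multiplicity_same_power [of "2 :: int" 2]
    by (subst prime_elem_multiplicity_mult_distrib) simp_all
  finally have m: "multiplicity 2 (4 * int n * d) = 2 + multiplicity 2 (int n)" .
  have "padic_valuation 2 (of_nat n) = multiplicity 2 (int n)"
    using padic_valuation_eqI [of 2 1 "of_nat n" "int n"] assms by simp
  moreover have "padic_valuation 2 ?B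
      = int (exceptional_exponent n) - (2 + int (multiplicity 2 (int n)))"
    using padic_valuation_eqI [OF two_is_prime_nat eq _ w(1)] d assms m
    by (auto simp: w(2))
  ultimately have val: "- padic_valuation 2 ?B
      = 2 + padic_valuation 2 (of_nat n) - int (exceptional_exponent n)" by simp
  \<comment> \<open>n is even if it is 6 modulo 12, and divisible by 4 if it is 0 modulo 12. Hence
    \<open>?B\<close> has valuation at most -2, which gives both the passage to the denominator and
    the divisibility by 4.\<close>
  have "exceptional_exponent n \<le> multiplicity 2 (int n)"
  proof (rule multiplicity_geI)
    show "2 ^ exceptional_exponent n dvd int n"
      unfolding exceptional_exponent_def by (auto; presburger)
  qed (use assms in auto)
  then have le: "2 \<le> - padic_valuation 2 ?B"
    using val \<open>padic_valuation 2 (of_nat n) = _\<close> by simp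
  then have denom: "padic_valuation 2 (of_int (rat_denom ?B)) = - padic_valuation 2 ?B"
    by (intro padic_valuation_denom) auto
  have "2 \<le> multiplicity 2 (rat_denom ?B)"
    using denom le by (simp add: padic_valuation_def)
  then have "2 ^ 2 dvd rat_denom ?B" by (rule multiplicity_dvd')
  with denom val show ?thesis by (auto simp: exceptional_exponent_def)
qed

end
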